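(* Let $\mathcal X,\mathcal Y$ be complex Banach spaces, let $A\in\mathcal B(\mathcal X)$, $B\in\mathcal B(\mathcal Y)$ and $C,Y\in\mathcal B(\mathcal Y,\mathcal X)$, and let $p$ be a polynomial with complex coefficients such that $$p(A)Y-Yp(B)=C .$$ Let $q(\lambda,\mu)=\dfrac{p(\lambda)-p(\mu)}{\lambda-\mu}$ be the divided difference of $p$. Then $X=q(A,B)(Y)$ satisfies $$AX-XB=C .$$
   Context: $\mathcal B(\mathcal Y,\mathcal X)$ denotes the bounded linear operators from $\mathcal Y$ to $\mathcal X$, and $\mathcal B(\mathcal X)=\mathcal B(\mathcal X,\mathcal X)$. For a bivariate polynomial $f(\lambda,\mu)=\sum_{i,j}\alpha_{ij}\lambda^i\mu^j$, $f(A,B)$ denotes the linear map on $\mathcal B(\mathcal Y,\mathcal X)$ given by $f(A,B)(Z)=\sum_{i,j}\alpha_{ij}A^iZB^j$. The divided difference $q$ is a bivariate polynomial: if $p(\lambda)=\sum_{k=0}^d\alpha_k\lambda^k$ then $q(\lambda,\mu)=\sum_{k=1}^d\alpha_k(\lambda^{k-1}+\lambda^{k-2}\mu+\cdots+\mu^{k-1})$. *)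

theory Defs
  imports Complex_Main "HOL-Computational_Algebra.Polynomial"
begin

class scaleC =
  fixes scaleC :: "complex \<Rightarrow> 'a \<Rightarrow> 'a"  (infixr \<open>*\<^sub>C\<close> 75)

class complex_vector = scaleC + ab_group_add +
  assumes scaleC_add_right: "a *\<^sub>C (x + y) = a *\<^sub>C x + a *\<^sub>C y"
    and scaleC_add_left: "(a + b) *\<^sub>C x = a *\<^sub>C x + b *\<^sub>C x"
    and scaleC_scaleC: "a *\<^sub>C (b *\<^sub>C x) = (a * b) *\<^sub>C x"
    and scaleC_one: "1 *\<^sub>C x = x"

text \<open>The axiom \<open>scaleR_scaleC\<close> makes the real structure of the library classes the restriction of the
  complex one.\<close>

class complex_normed_vector = complex_vector + real_normed_vector +
  assumes scaleR_scaleC: "r *\<^sub>R x = complex_of_real r *\<^sub>C x"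
    and norm_scaleC: "norm (a *\<^sub>C x) = cmod a * norm x"

class complex_banach = complex_normed_vector + complete_space

instantiation complex :: complex_banach
begin
definition scaleC_complex :: "complex \<Rightarrow> complex \<Rightarrow> complex"
  where "scaleC_complex = (*)"
instance
  by standard (auto simp: scaleC_complex_def algebra_simps norm_mult scaleR_conv_of_real)
end

lemma scaleC_sum_right:
  "a *\<^sub>C (\<Sum>i\<in>I. f i) = (\<Sum>i\<in>I. a *\<^sub>C (f i :: 'a::complex_vector))"
proof -
  interpret additive "scaleC a :: 'a \<Rightarrow> 'a"
    by standard (rule scaleC_add_right)
  show ?thesis by (rule sum)
qed

lemma bounded_linear_scaleC: "bounded_linear (scaleC a :: 'a::complex_normed_vector \<Rightarrow> 'a)"
  by (rule bounded_linear_intro[where K = "cmod a"])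
    (auto simp: scaleC_add_right scaleR_scaleC scaleC_scaleC norm_scaleC mult.commute)

definition bounded_clinear :: "('a::complex_normed_vector \<Rightarrow> 'b::complex_normed_vector) \<Rightarrow> bool"
  where "bounded_clinear f \<longleftrightarrow> bounded_linear f \<and> (\<forall>a x. f (a *\<^sub>C x) = a *\<^sub>C f x)"

lemma scaleC_minus_right: "a *\<^sub>C (- x) = - (a *\<^sub>C (x :: 'a::complex_vector))"
proof -
  interpret additive "scaleC a :: 'a \<Rightarrow> 'a"
    by standard (rule scaleC_add_right)
  show ?thesis by (rule minus)
qed

lemma bounded_clinear_zero: "bounded_clinear (\<lambda>_. 0)"
  using scaleC_sum_right[of _ "\<lambda>_. 0" "{}"] by (auto simp: bounded_clinear_def)

lemma bounded_clinear_id: "bounded_clinear (\<lambda>x. x)"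
  by (auto simp: bounded_clinear_def)

lemma bounded_clinear_add:
  "bounded_clinear f \<Longrightarrow> bounded_clinear g \<Longrightarrow> bounded_clinear (\<lambda>x. f x + g x)"
  by (auto simp: bounded_clinear_def bounded_linear_add scaleC_add_right)

lemma bounded_clinear_minus: "bounded_clinear f \<Longrightarrow> bounded_clinear (\<lambda>x. - f x)"
  by (auto simp: bounded_clinear_def bounded_linear_minus scaleC_minus_right)

lemma bounded_clinear_scaleC: "bounded_clinear f \<Longrightarrow> bounded_clinear (\<lambda>x. a *\<^sub>C f x)"
  by (auto simp: bounded_clinear_def scaleC_scaleC mult.commute
      intro: bounded_linear_compose[OF bounded_linear_scaleC])

lemma bounded_clinear_compose:
  "bounded_clinear f \<Longrightarrow> bounded_clinear g \<Longrightarrow> bounded_clinear (\<lambda>x. f (g x))"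
  by (auto simp: bounded_clinear_def bounded_linear_compose)

typedef (overloaded) ('a, 'b) cblinfun  (\<open>(_ \<Rightarrow>\<^sub>C\<^sub>L _)\<close> [22, 21] 21) =
  "{f :: 'a::complex_normed_vector \<Rightarrow> 'b::complex_normed_vector. bounded_clinear f}"
  morphisms cblinfun_apply CBlinfun
  by (blast intro: bounded_clinear_zero)

setup_lifting type_definition_cblinfun

instantiation cblinfun :: (complex_normed_vector, complex_normed_vector) complex_vector
begin

lift_definition zero_cblinfun :: "'a \<Rightarrow>\<^sub>C\<^sub>L 'b" is "\<lambda>_. 0"
  by (rule bounded_clinear_zero)

lift_definition plus_cblinfun :: "('a \<Rightarrow>\<^sub>C\<^sub>L 'b) \<Rightarrow> ('a \<Rightarrow>\<^sub>C\<^sub>L 'b) \<Rightarrow> 'a \<Rightarrow>\<^sub>C\<^sub>L 'b"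
  is "\<lambda>f g x. f x + g x"
  by (rule bounded_clinear_add)

lift_definition uminus_cblinfun :: "('a \<Rightarrow>\<^sub>C\<^sub>L 'b) \<Rightarrow> 'a \<Rightarrow>\<^sub>C\<^sub>L 'b" is "\<lambda>f x. - f x"
  by (rule bounded_clinear_minus)

definition minus_cblinfun :: "('a \<Rightarrow>\<^sub>C\<^sub>L 'b) \<Rightarrow> ('a \<Rightarrow>\<^sub>C\<^sub>L 'b) \<Rightarrow> 'a \<Rightarrow>\<^sub>C\<^sub>L 'b"
  where "minus_cblinfun f g = f + - g"

lift_definition scaleC_cblinfun :: "complex \<Rightarrow> ('a \<Rightarrow>\<^sub>C\<^sub>L 'b) \<Rightarrow> 'a \<Rightarrow>\<^sub>C\<^sub>L 'b"
  is "\<lambda>a f x. a *\<^sub>C f x"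
  by (rule bounded_clinear_scaleC)

instance
  by standard
    (unfold minus_cblinfun_def,
     (transfer, auto simp: fun_eq_iff scaleC_add_right scaleC_add_left scaleC_scaleC scaleC_one)+)

end

lift_definition cblinfun_id :: "'a::complex_normed_vector \<Rightarrow>\<^sub>C\<^sub>L 'a" is "\<lambda>x. x"
  by (rule bounded_clinear_id)

lift_definition cblinfun_compose ::
  "('b::complex_normed_vector \<Rightarrow>\<^sub>C\<^sub>L 'c::complex_normed_vector) \<Rightarrow>
   ('a::complex_normed_vector \<Rightarrow>\<^sub>C\<^sub>L 'b) \<Rightarrow> 'a \<Rightarrow>\<^sub>C\<^sub>L 'c"  (infixl \<open>o\<^sub>C\<^sub>L\<close> 67)
  is "\<lambda>f g x. f (g x)"
  by (rule bounded_clinear_compose)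

primrec cblinfun_power :: "('a::complex_normed_vector \<Rightarrow>\<^sub>C\<^sub>L 'a) \<Rightarrow> nat \<Rightarrow> 'a \<Rightarrow>\<^sub>C\<^sub>L 'a"
  where
    "cblinfun_power A 0 = cblinfun_id"
  | "cblinfun_power A (Suc n) = A o\<^sub>C\<^sub>L cblinfun_power A n"

definition poly_op :: "complex poly \<Rightarrow> ('a::complex_normed_vector \<Rightarrow>\<^sub>C\<^sub>L 'a) \<Rightarrow> 'a \<Rightarrow>\<^sub>C\<^sub>L 'a"
  where "poly_op p A = (\<Sum>k\<le>degree p. coeff p k *\<^sub>C cblinfun_power A k)"

text \<open>A bivariate polynomial \<open>f(\<lambda>,\<mu>)\<close> is encoded as a polynomial in \<open>\<lambda>\<close> (outer) whose
  coefficients are polynomials in \<open>\<mu>\<close> (inner): the coefficient of \<open>\<lambda>\<^sup>i \<mu>\<^sup>j\<close> is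
  \<open>coeff (coeff f i) j\<close>.\<close>

definition bipoly_op ::
  "complex poly poly \<Rightarrow> ('x::complex_normed_vector \<Rightarrow>\<^sub>C\<^sub>L 'x) \<Rightarrow>
   ('y::complex_normed_vector \<Rightarrow>\<^sub>C\<^sub>L 'y) \<Rightarrow> ('y \<Rightarrow>\<^sub>C\<^sub>L 'x) \<Rightarrow> 'y \<Rightarrow>\<^sub>C\<^sub>L 'x"
  where "bipoly_op f A B Z =
    (\<Sum>i\<le>degree f. \<Sum>j\<le>degree (coeff f i).
       coeff (coeff f i) j *\<^sub>C (cblinfun_power A i o\<^sub>C\<^sub>L Z o\<^sub>C\<^sub>L cblinfun_power B j))"

definition divided_difference :: "complex poly \<Rightarrow> complex poly poly"
  where "divided_difference p =
    (\<Sum>k=1..degree p. \<Sum>j<k. monom (monom (coeff p k) j) (k - 1 - j))"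

text \<open>Here \<open>[:0, 1:]\<close> is \<open>\<lambda>\<close>, \<open>[:[:0, 1:]:]\<close> is \<open>\<mu>\<close>,
  and \<open>map_poly (\<lambda>a. [:a:]) p\<close> and \<open>[:p:]\<close> are \<open>p(\<lambda>)\<close> and \<open>p(\<mu>)\<close>.\<close>

lemma divided_difference_quotient:
  "([:0, 1:] - [:[:0, 1:]:]) * divided_difference p = map_poly (\<lambda>a. [:a:]) p - [:p:]"
proof -
  let ?l = "[:0, 1:] :: complex poly poly" and ?m = "[:[:0, 1:]:] :: complex poly poly"
  have mon: "monom (monom a j) i = [:[:a:]:] * ?l ^ i * ?m ^ j" for a :: complex and i j
    by (simp add: monom_altdef poly_const_pow smult_smult)
  have pl: "map_poly (\<lambda>a. [:a:]) p = (\<Sum>k\<le>degree p. [:[:coeff p k:]:] * ?l ^ k)"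
  proof -
    have "map_poly (\<lambda>a. [:a:]) p = (\<Sum>k\<le>degree p. monom [:coeff p k:] k)"
      by (rule poly_eqI) (auto simp: coeff_map_poly coeff_sum coeff_eq_0 if_distrib cong: if_cong)
    then show ?thesis by (simp add: monom_altdef)
  qed
  have pm: "[:p:] = (\<Sum>k\<le>degree p. [:[:coeff p k:]:] * ?m ^ k)"
  proof -
    have "[:p:] = [:\<Sum>k\<le>degree p. monom (coeff p k) k:]"
      by (simp add: poly_as_sum_of_monoms)
    also have "\<dots> = (\<Sum>k\<le>degree p. [:monom (coeff p k) k:])"
      by (induct "degree p") (rule poly_eqI, auto simp: coeff_sum coeff_pCons split: nat.split)+
    finally show ?thesis by (simp add: monom_altdef poly_const_pow)
  qed
  have "(?l - ?m) * divided_difference p =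
      (\<Sum>k=1..degree p. [:[:coeff p k:]:] * ((?l - ?m) * (\<Sum>j<k. ?l ^ (k - Suc j) * ?m ^ j)))"
    unfolding divided_difference_def mon by (simp only: sum_distrib_left mult_ac diff_diff_left plus_1_eq_Suc)
  also have "\<dots> = (\<Sum>k=1..degree p. [:[:coeff p k:]:] * (?l ^ k - ?m ^ k))"
  proof -
    have "(?l - ?m) * (\<Sum>j<k. ?l ^ (k - Suc j) * ?m ^ j) = ?l ^ k - ?m ^ k" for k
    proof -
      have "?l ^ k - ?m ^ k = - ((?m - ?l) * (\<Sum>j<k. ?l ^ (k - Suc j) * ?m ^ j))"
        unfolding power_diff_sumr2[of ?m k ?l, symmetric] by (rule minus_diff_eq[symmetric])
      then show ?thesis
        unfolding mult_minus_left[symmetric] minus_diff_eq by (rule sym)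
    qed
    then show ?thesis by (intro sum.cong refl arg_cong2[where f = times])
  qed
  also have "\<dots> = (\<Sum>k\<le>degree p. [:[:coeff p k:]:] * (?l ^ k - ?m ^ k))"
    by (rule sum.mono_neutral_left) (auto simp: not_le less_Suc_eq_0_disj)
  also have "\<dots> = map_poly (\<lambda>a. [:a:]) p - [:p:]"
    unfolding pl pm by (simp only: right_diff_distrib sum_subtractf)
  finally show ?thesis .
qed

end

theory Submission
  imports Defs
begin

text \<open>Since \<open>f \<mapsto> f(A,B)(Y)\<close> is additive, \<open>X\<close> is a combination of the operators
  \<open>\<Sum>j<k. A\<^sup>k\<^sup>-\<^sup>1\<^sup>-\<^sup>j Y B\<^sup>j\<close> with the coefficients of \<open>p\<close>, and \<open>Z \<mapsto> A Z - Z B\<close> makes each of these sums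
  telescope to \<open>A\<^sup>k Y - Y B\<^sup>k\<close>.\<close>

text \<open>Coefficients above the degree are 0 and \<open>G\<close> kills them, so a sum up to the
  degree may be extended to any larger bound.\<close>

lemma sum_coeff_mono_degree:
  fixes G :: "nat \<Rightarrow> 'a::zero \<Rightarrow> 'v::comm_monoid_add"
  assumes "\<And>i. G i 0 = 0" and "degree f \<le> n"
  shows "(\<Sum>i\<le>degree f. G i (coeff f i)) = (\<Sum>i\<le>n. G i (coeff f i))"
  using assms by (intro sum.mono_neutral_left) (auto simp: coeff_eq_0)

text \<open>Cancellation can make \<open>degree (f + g)\<close> smaller than both degrees, so all
  three sums are first brought to one range. \<open>G\<close> stays abstract to serve both the outer
  and the inner sum of \<open>bipoly_op\<close>.\<close>

lemma sum_coeff_add: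
  fixes G :: "nat \<Rightarrow> 'a::comm_monoid_add \<Rightarrow> 'v::comm_monoid_add"
  assumes zero: "\<And>i. G i 0 = 0" and add: "\<And>i a b. G i (a + b) = G i a + G i b"
  shows "(\<Sum>i\<le>degree (f + g). G i (coeff (f + g) i)) =
    (\<Sum>i\<le>degree f. G i (coeff f i)) + (\<Sum>i\<le>degree g. G i (coeff g i))"
proof -
  let ?n = "max (degree f) (degree g)"
  have le: "degree (f + g) \<le> ?n" "degree f \<le> ?n" "degree g \<le> ?n"
    by (simp_all add: degree_add_le_max)
  show ?thesis
    unfolding le[THEN sum_coeff_mono_degree[where G = G, OF zero]] by (simp add: add sum.distrib)
qed

lemma sum_coeff_monom:
  fixes G :: "nat \<Rightarrow> 'a::comm_monoid_add \<Rightarrow> 'v::comm_monoid_add"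
  assumes zero: "\<And>i. G i 0 = 0"
  shows "(\<Sum>i\<le>degree (monom a n). G i (coeff (monom a n) i)) = G n a"
proof -
  have "(\<Sum>i\<le>degree (monom a n). G i (coeff (monom a n) i)) = (\<Sum>i\<le>n. if i = n then G n a else 0)"
    \<comment> \<open>For \<open>a = 0\<close> the degree is 0 instead of \<open>n\<close>; only the
      upper bound \<open>n\<close> is available in general.\<close>
    unfolding sum_coeff_mono_degree[where G = G, OF zero degree_monom_le]
    by (intro sum.cong) (auto simp: zero)
  then show ?thesis by simp
qed

lemma scaleC_zero_left: "0 *\<^sub>C x = (0 :: 'a::complex_vector)"
  using scaleC_add_left[of 0 0 x] by simp

lemma bipoly_op_add: "bipoly_op (f + g) A B Z = bipoly_op f A B Z + bipoly_op g A B Z"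
  unfolding bipoly_op_def
  \<comment> \<open>Additivity is applied in the outer variable, where \<open>h\<close> is a
    polynomial coefficient, and then in the inner one, where \<open>c\<close> is a scalar.\<close>
  by (intro sum_coeff_add[where G = "\<lambda>i h. \<Sum>j\<le>degree h. coeff h j *\<^sub>C
        (cblinfun_power A i o\<^sub>C\<^sub>L Z o\<^sub>C\<^sub>L cblinfun_power B j)"]
      sum_coeff_add[where G = "\<lambda>j c. c *\<^sub>C (cblinfun_power A _ o\<^sub>C\<^sub>L Z o\<^sub>C\<^sub>L cblinfun_power B j)"])
    (simp_all add: scaleC_zero_left scaleC_add_left)

lemma bipoly_op_sum: "bipoly_op (\<Sum>i\<in>I. f i) A B Z = (\<Sum>i\<in>I. bipoly_op (f i) A B Z)"
proof -
  interpret additive "\<lambda>f. bipoly_op f A B Z"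
    by standard (rule bipoly_op_add)
  show ?thesis by (rule sum)
qed

lemma bipoly_op_monom:
  "bipoly_op (monom (monom a j) i) A B Z = a *\<^sub>C (cblinfun_power A i o\<^sub>C\<^sub>L Z o\<^sub>C\<^sub>L cblinfun_power B j)"
  unfolding bipoly_op_def
  \<comment> \<open>Evaluating the outer monomial leaves the sum over its coefficient
    \<open>monom a j\<close>, to which the same lemma applies.\<close>
  by (subst sum_coeff_monom[where G = "\<lambda>i h. \<Sum>j\<le>degree h. coeff h j *\<^sub>C
        (cblinfun_power A i o\<^sub>C\<^sub>L Z o\<^sub>C\<^sub>L cblinfun_power B j)"],
      simp add: scaleC_zero_left)
    (rule sum_coeff_monom[where G = "\<lambda>j c. c *\<^sub>C (cblinfun_power A i o\<^sub>C\<^sub>L Z o\<^sub>C\<^sub>L cblinfun_power B j)"],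
      rule scaleC_zero_left)

lemma cblinfun_compose_assoc: "(F o\<^sub>C\<^sub>L G) o\<^sub>C\<^sub>L H = F o\<^sub>C\<^sub>L (G o\<^sub>C\<^sub>L H)"
  by transfer simp

lemma cblinfun_compose_id_left: "cblinfun_id o\<^sub>C\<^sub>L F = F"
  by transfer simp

lemma cblinfun_compose_id_right: "F o\<^sub>C\<^sub>L cblinfun_id = F"
  by transfer simp

lemma cblinfun_compose_add_left: "(F + G) o\<^sub>C\<^sub>L H = (F o\<^sub>C\<^sub>L H) + (G o\<^sub>C\<^sub>L H)"
  by transfer simp

lemma cblinfun_compose_add_right: "F o\<^sub>C\<^sub>L (G + H) = (F o\<^sub>C\<^sub>L G) + (F o\<^sub>C\<^sub>L H)"
  by transfer (simp add: bounded_clinear_def linear_add bounded_linear.linear)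

lemma cblinfun_compose_scaleC_left: "(a *\<^sub>C F) o\<^sub>C\<^sub>L G = a *\<^sub>C (F o\<^sub>C\<^sub>L G)"
  by transfer simp

lemma cblinfun_compose_scaleC_right: "F o\<^sub>C\<^sub>L (a *\<^sub>C G) = a *\<^sub>C (F o\<^sub>C\<^sub>L G)"
  by transfer (simp add: bounded_clinear_def)

lemma cblinfun_compose_sum_left: "(\<Sum>i\<in>I. F i) o\<^sub>C\<^sub>L G = (\<Sum>i\<in>I. F i o\<^sub>C\<^sub>L G)"
proof -
  interpret additive "\<lambda>F. F o\<^sub>C\<^sub>L G"
    by standard (rule cblinfun_compose_add_left)
  show ?thesis by (rule sum)
qed

lemma cblinfun_compose_sum_right: "F o\<^sub>C\<^sub>L (\<Sum>i\<in>I. G i) = (\<Sum>i\<in>I. F o\<^sub>C\<^sub>L G i)"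
proof -
  interpret additive "\<lambda>G. F o\<^sub>C\<^sub>L G"
    by standard (rule cblinfun_compose_add_right)
  show ?thesis by (rule sum)
qed

lemma scaleC_diff_right: "a *\<^sub>C (x - y) = a *\<^sub>C x - a *\<^sub>C (y :: 'a::complex_vector)"
  using scaleC_add_right[of a x "- y"] by (simp add: scaleC_minus_right)

text \<open>\<open>B\<close> multiplies from the right, whereas \<open>cblinfun_power\<close> adds
  its new factor on the left.\<close>

lemma cblinfun_power_Suc_right: "cblinfun_power A (Suc n) = cblinfun_power A n o\<^sub>C\<^sub>L A"
  by (induction n) (simp_all add: cblinfun_compose_id_left cblinfun_compose_id_right flip: cblinfun_compose_assoc)

lemma sum_cblinfun_power_telescope:
  "(\<Sum>j<k. (A o\<^sub>C\<^sub>L (cblinfun_power A (k - 1 - j) o\<^sub>C\<^sub>L Y o\<^sub>C\<^sub>L cblinfun_power B j)) -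
      ((cblinfun_power A (k - 1 - j) o\<^sub>C\<^sub>L Y o\<^sub>C\<^sub>L cblinfun_power B j) o\<^sub>C\<^sub>L B)) =
    (cblinfun_power A k o\<^sub>C\<^sub>L Y) - (Y o\<^sub>C\<^sub>L cblinfun_power B k)"
  (is "sum ?d _ = _")
proof -
  \<comment> \<open>The exponents in \<open>?f j\<close> add up to \<open>k\<close>, one more than
    in the summands: a factor \<open>A\<close> on the left produces \<open>?f j\<close>, a factor
    \<open>B\<close> on the right produces \<open>?f (Suc j)\<close>.\<close>
  let ?f = "\<lambda>j. cblinfun_power A (k - j) o\<^sub>C\<^sub>L Y o\<^sub>C\<^sub>L cblinfun_power B j"
  have "?d j = ?f j - ?f (Suc j)" if "j < k" for j
  proof -
    \<comment> \<open>The first equation needs \<open>j < k\<close>, since subtraction on naturals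
      truncates.\<close>
    have "k - j = Suc (k - 1 - j)" and "k - Suc j = k - 1 - j" using that by auto
    then show ?thesis
      by (simp only: cblinfun_power.simps(2)[of A] cblinfun_power_Suc_right[of B]
          cblinfun_compose_assoc)
  qed
  then have "sum ?d {..<k} = (\<Sum>j<k. ?f j - ?f (Suc j))" by (intro sum.cong) auto
  also have "\<dots> = ?f 0 - ?f k" by (rule sum_lessThan_telescope')
  finally show ?thesis by (simp add: cblinfun_compose_id_left cblinfun_compose_id_right)
qed

theorem proposition2p2:
  fixes A :: "'x::complex_banach \<Rightarrow>\<^sub>C\<^sub>L 'x"
    and B :: "'y::complex_banach \<Rightarrow>\<^sub>C\<^sub>L 'y"
    and C Y X :: "'y \<Rightarrow>\<^sub>C\<^sub>L 'x"
    and p :: "complex poly"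
  assumes "poly_op p A o\<^sub>C\<^sub>L Y - Y o\<^sub>C\<^sub>L poly_op p B = C"
    and "X = bipoly_op (divided_difference p) A B Y"
  shows "A o\<^sub>C\<^sub>L X - X o\<^sub>C\<^sub>L B = C"
proof -
  let ?T = "\<lambda>k j. cblinfun_power A (k - 1 - j) o\<^sub>C\<^sub>L Y o\<^sub>C\<^sub>L cblinfun_power B j"
  let ?D = "\<lambda>k. (cblinfun_power A k o\<^sub>C\<^sub>L Y) - (Y o\<^sub>C\<^sub>L cblinfun_power B k)"
  have X: "X = (\<Sum>k=1..degree p. coeff p k *\<^sub>C (\<Sum>j<k. ?T k j))"
    by (simp only: assms(2) divided_difference_def bipoly_op_sum bipoly_op_monom scaleC_sum_right)
  have "(A o\<^sub>C\<^sub>L X) - (X o\<^sub>C\<^sub>L B) =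
      (\<Sum>k=1..degree p. coeff p k *\<^sub>C (\<Sum>j<k. (A o\<^sub>C\<^sub>L ?T k j) - (?T k j o\<^sub>C\<^sub>L B)))"
    by (simp only: X cblinfun_compose_sum_left cblinfun_compose_sum_right
        cblinfun_compose_scaleC_left cblinfun_compose_scaleC_right sum_subtractf scaleC_diff_right)
  also have "\<dots> = (\<Sum>k=1..degree p. coeff p k *\<^sub>C ?D k)"
    by (simp only: sum_cblinfun_power_telescope)
  \<comment> \<open>The divided difference does not see the constant term of \<open>p\<close>, while
    \<open>poly_op\<close> does; that term contributes a multiple of \<open>Y - Y\<close>.\<close>
  also have "\<dots> = (\<Sum>k\<le>degree p. coeff p k *\<^sub>C ?D k)"
  proof (rule sum.mono_neutral_left)
    have "?D 0 = 0" by (simp add: cblinfun_compose_id_left cblinfun_compose_id_right)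
    moreover have "k = 0" if "k \<in> {..degree p} - {1..degree p}" for k
      using that by auto
    ultimately show "\<forall>k\<in>{..degree p} - {1..degree p}. coeff p k *\<^sub>C ?D k = 0"
      \<comment> \<open>This instance yields that a scalar multiple of 0 is 0.\<close>
      using scaleC_diff_right[of _ 0 0] by fastforce
  qed auto
  also have "\<dots> = (poly_op p A o\<^sub>C\<^sub>L Y) - (Y o\<^sub>C\<^sub>L poly_op p B)"
    by (simp only: poly_op_def cblinfun_compose_sum_left cblinfun_compose_sum_right
        cblinfun_compose_scaleC_left cblinfun_compose_scaleC_right sum_subtractf scaleC_diff_right)
  finally show ?thesis using assms(1) by simp
qed

end
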